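(* For every integer $n\geq 0$, $5\mid MO(2,5n+2)$.
   Context: For $t\geq 1$, the integers $MO(t,n)$ are defined by the formal power series $$U_t(q)=\sum_{n\geq0}MO(t,n)\,q^n=\sum_{1\leq k_1<k_2<\cdots<k_t}\frac{q^{k_1+k_2+\cdots+k_t}}{(1-q^{k_1})^2(1-q^{k_2})^2\cdots(1-q^{k_t})^2}.$$ *)

theory Defs
  imports "HOL-Analysis.Analysis"
begin

definition MO_index :: "nat \<Rightarrow> nat list set" where
  "MO_index t = {ks. length ks = t \<and> sorted_wrt (<) ks \<and> (\<forall>k\<in>set ks. 1 \<le> k)}"

text \<open>
  Division on formal power series needs a division on the coefficients, which \<^typ>\<open>int\<close> lacks.
  The denominator has constant term 1, so it is a unit of \<^typ>\<open>int fps\<close>, and its inverse is the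
  library's \<^term>\<open>fps_right_inverse\<close> with constant term 1; see \<open>MO_denom_inverse\<close>.
\<close>

definition MO_denom :: "nat list \<Rightarrow> int fps" where
  "MO_denom ks = (\<Prod>k\<leftarrow>ks. (1 - fps_X ^ k)\<^sup>2)"

definition MO_term :: "nat list \<Rightarrow> int fps" where
  "MO_term ks = fps_X ^ sum_list ks * fps_right_inverse (MO_denom ks) 1"

text \<open>
  The infinite sum is taken in the \<open>X\<close>-adic topology of \<^typ>\<open>int fps\<close>; it converges by
  \<open>MO_term_summable\<close>. The mathematical definition is for \<open>t \<ge> 1\<close>; here the value at \<open>t = 0\<close> is
  that of the empty product, 1.
\<close>

definition U :: "nat \<Rightarrow> int fps" where
  "U t = (\<Sum>\<^sub>\<infinity>ks\<in>MO_index t. MO_term ks)"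

definition MO :: "nat \<Rightarrow> nat \<Rightarrow> int" where
  "MO t n = fps_nth (U t) n"

lemma MO_denom_nth_0:
  assumes "ks \<in> MO_index t"
  shows "fps_nth (MO_denom ks) 0 = 1"
proof -
  have "\<forall>k\<in>set ks. 1 \<le> k \<Longrightarrow> fps_nth (MO_denom ks) 0 = 1"
    by (induction ks) (auto simp: MO_denom_def power2_eq_square)
  with assms show ?thesis by (auto simp: MO_index_def)
qed

lemma MO_denom_inverse:
  assumes "ks \<in> MO_index t"
  shows "MO_denom ks * fps_right_inverse (MO_denom ks) 1 = 1"
  by (rule fps_right_inverse) (simp add: MO_denom_nth_0[OF assms])

lemma MO_term_finite: "finite {ks \<in> MO_index t. fps_nth (MO_term ks) n \<noteq> 0}"
proof (rule finite_subset)
  show "{ks \<in> MO_index t. fps_nth (MO_term ks) n \<noteq> 0} \<subseteq> {ks. set ks \<subseteq> {..n} \<and> length ks = t}"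
  proof safe
    fix ks k
    assume ks: "ks \<in> MO_index t" "fps_nth (MO_term ks) n \<noteq> 0" "k \<in> set ks"
    from ks(2) have "sum_list ks \<le> n"
      by (auto simp: MO_term_def fps_X_power_mult_nth split: if_splits)
    with member_le_sum_list[OF ks(3)] show "k \<le> n" by simp
  qed (auto simp: MO_index_def)
  show "finite {ks. set ks \<subseteq> {..n} \<and> length ks = t}"
    by (rule finite_lists_length_eq) simp
qed

lemma MO_term_summable: "MO_term summable_on MO_index t"
proof -
  have "(MO_term has_sum Abs_fps (\<lambda>n. \<Sum>ks | ks \<in> MO_index t \<and> fps_nth (MO_term ks) n \<noteq> 0.
      fps_nth (MO_term ks) n)) (MO_index t)"
    by (rule has_sum_fpsI) (simp_all add: MO_term_finite)
  then show ?thesis by (auto simp: summable_on_def)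
qed

end

theory Submission
  imports Defs "HOL-Number_Theory.Cong"
begin

text \<open>
  Expanding \<open>q\<^sup>k/(1-q\<^sup>k)\<^sup>2 = \<Sum>\<^sub>a a q\<^sup>a\<^sup>k\<close> turns \<open>MO 2 n\<close> into the sum of \<open>a b\<close> over all positive
  solutions of \<open>a x + b y = n\<close> with \<open>x < y\<close> (\<open>MO_2_eq\<close>). For \<open>n > 0\<close> it has a closed form,
  \<open>8 MO 2 n = \<sigma>\<^sub>3(n) + (1 - 2n) \<sigma>\<^sub>1(n)\<close> (\<open>eight_times_MO_2\<close>), usually obtained from the
  identity for the square of the Eisenstein series \<open>E\<^sub>2\<close>. Here it is proved by the elementary method
  of Liouville: one step of the Euclidean algorithm on \<open>a x + b y\<close> matches the solutions with
  \<open>a > b\<close> to those with \<open>x < y\<close> (\<open>sum_sols_euclid\<close>). For the weights \<open>a b\<close>, \<open>a\<^sup>2\<close> and \<open>b\<^sup>2\<close> this gives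
  enough linear relations to express the wanted sum through the degenerate solutions \<open>a = b\<close> and
  \<open>x = y\<close> alone (\<open>four_times_sum_sols\<close>), and those are sums over divisors.

  If \<open>n \<equiv> 2\<close> modulo 5, complementary divisors \<open>d\<close> and \<open>e = n/d\<close> satisfy \<open>d e \<equiv> 2\<close>, so their
  residues are \<open>{1, 2}\<close> or \<open>{3, 4}\<close>, and in both cases the two summands \<open>d\<^sup>3 + (1 - 2n) d\<close> and
  \<open>e\<^sup>3 + (1 - 2n) e\<close> cancel modulo 5. Summing over all \<open>d\<close> counts every pair twice, hence 5 divides
  \<open>16 MO 2 n\<close>.
\<close>

section \<open>Coefficients as sums over solutions of \<open>a x + b y = n\<close>\<close>

definition sols :: "nat \<Rightarrow> (nat \<times> nat \<times> nat \<times> nat) set" where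
  "sols n = {(a, x, b, y). 0 < a \<and> 0 < x \<and> 0 < b \<and> 0 < y \<and> a * x + b * y = n}"

text \<open>The expansion of \<open>q\<^sup>k / (1 - q\<^sup>k)\<^sup>2\<close>, given by its coefficients so that no division is needed.\<close>

definition lambert :: "nat \<Rightarrow> int fps" where
  "lambert k = Abs_fps (\<lambda>m. if k dvd m then int (m div k) else 0)"

lemma finite_sols: "finite (sols n)"
proof (rule finite_subset)
  show "sols n \<subseteq> {..n} \<times> {..n} \<times> {..n} \<times> {..n}"
  proof (clarsimp simp: sols_def)
    fix a x b y :: nat assume pos: "0 < a" "0 < x" "0 < b" "0 < y"
    have "a * 1 \<le> a * x" "1 * x \<le> a * x" "b * 1 \<le> b * y" "1 * y \<le> b * y"
      using pos by (intro mult_le_mono; simp)+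
    then show "a \<le> a * x + b * y \<and> x \<le> a * x + b * y \<and> b \<le> a * x + b * y \<and> y \<le> a * x + b * y"
      by linarith
  qed
qed simp

text \<open>
  Each factor \<open>1 - q\<^sup>k\<close> takes differences of coefficients at distance \<open>k\<close>: the first one turns the
  coefficients \<open>1, 2, 3, \<dots>\<close> at the positive multiples of \<open>k\<close> into \<open>1, 1, 1, \<dots>\<close>, the second one
  leaves only the coefficient at \<open>k\<close>.
\<close>

lemma lambert_mult_denom:
  assumes "k \<ge> 1"
  shows "lambert k * (1 - fps_X ^ k)\<^sup>2 = fps_X ^ k"
proof -
  define H :: "int fps" where "H = Abs_fps (\<lambda>m. if k dvd m \<and> 0 < m then 1 else 0)"
  have dvd_small: "m = 0" if "k dvd m" "m < k" for m
    using that by (meson dvd_imp_le not_gr_zero not_less)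
  have "lambert k * (1 - fps_X ^ k) = H"
  proof (rule fps_ext)
    fix m
    show "fps_nth (lambert k * (1 - fps_X ^ k)) m = fps_nth H m"
    proof (cases "m < k")
      case True
      then show ?thesis using dvd_small[of m]
        by (auto simp: H_def lambert_def algebra_simps fps_X_power_mult_nth)
    next
      case False
      with assms have "k dvd m \<longleftrightarrow> k dvd (m - k)" "m div k = Suc ((m - k) div k)" "0 < m"
        by (auto simp: dvd_minus_self le_div_geq)
      with False show ?thesis
        by (simp add: H_def lambert_def algebra_simps fps_X_power_mult_nth)
    qed
  qed
  moreover have "H * (1 - fps_X ^ k) = fps_X ^ k"
  proof (rule fps_ext)
    fix m
    show "fps_nth (H * (1 - fps_X ^ k)) m = fps_nth (fps_X ^ k) m"
    proof (cases "m \<le> k")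
      case True
      then show ?thesis using dvd_small[of m] assms
        by (auto simp: H_def algebra_simps fps_X_power_mult_nth fps_X_power_nth)
    next
      case False
      then have "k dvd m \<longleftrightarrow> k dvd (m - k)" by (simp add: dvd_minus_self)
      with False show ?thesis
        by (simp add: H_def algebra_simps fps_X_power_mult_nth fps_X_power_nth)
    qed
  qed
  ultimately show ?thesis by (simp add: power2_eq_square flip: mult.assoc)
qed

lemma MO_term_eq_lambert:
  assumes "ks \<in> MO_index t"
  shows "MO_term ks = (\<Prod>k\<leftarrow>ks. lambert k)"
proof -
  have eq: "(\<Prod>k\<leftarrow>ks. lambert k) * MO_denom ks = fps_X ^ sum_list ks"
    if "\<forall>k\<in>set ks. 1 \<le> k" for ks
    using that
  proof (induction ks)
    case (Cons k ks)
    have "(\<Prod>k\<leftarrow>k # ks. lambert k) * MO_denom (k # ks) =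
        (lambert k * (1 - fps_X ^ k)\<^sup>2) * ((\<Prod>k\<leftarrow>ks. lambert k) * MO_denom ks)"
      by (simp add: MO_denom_def algebra_simps)
    with Cons show ?case by (simp add: lambert_mult_denom power_add)
  qed (simp add: MO_denom_def)
  have "MO_term ks = (\<Prod>k\<leftarrow>ks. lambert k) * (MO_denom ks * fps_right_inverse (MO_denom ks) 1)"
    using eq[of ks] assms by (simp add: MO_term_def MO_index_def flip: mult.assoc)
  then show ?thesis by (simp add: MO_denom_inverse[OF assms])
qed

text \<open>
  In the \<open>X\<close>-adic topology the \<open>n\<close>-th coefficient of an infinite sum is a finite sum, and it may be
  taken over any finite index set that contains all the terms contributing to it.
\<close>

lemma MO_eq_sum:
  assumes "finite A" "A \<subseteq> MO_index t"
    and "\<And>ks. ks \<in> MO_index t \<Longrightarrow> ks \<notin> A \<Longrightarrow> fps_nth (MO_term ks) n = 0"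
  shows "MO t n = (\<Sum>ks\<in>A. fps_nth (MO_term ks) n)"
proof -
  have "(MO_term has_sum Abs_fps (\<lambda>n. \<Sum>ks | ks \<in> MO_index t \<and> fps_nth (MO_term ks) n \<noteq> 0.
      fps_nth (MO_term ks) n)) (MO_index t)"
    by (rule has_sum_fpsI) (simp_all add: MO_term_finite)
  then have "MO t n = (\<Sum>ks | ks \<in> MO_index t \<and> fps_nth (MO_term ks) n \<noteq> 0. fps_nth (MO_term ks) n)"
    by (simp add: MO_def U_def infsumI)
  also have "\<dots> = (\<Sum>ks\<in>A. fps_nth (MO_term ks) n)"
    using assms by (intro sum.mono_neutral_left) auto
  finally show ?thesis .
qed

lemma lambert_mult_nth:
  assumes "x \<ge> 1" "y \<ge> 1"
  shows "fps_nth (lambert x * lambert y) n =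
    (\<Sum>(a, b) | 0 < a \<and> 0 < b \<and> a * x + b * y = n. int (a * b))"
proof -
  let ?I = "{i \<in> {0..n}. x dvd i \<and> y dvd (n - i) \<and> 0 < i div x \<and> 0 < (n - i) div y}"
  have "fps_nth (lambert x * lambert y) n = (\<Sum>i\<in>?I. int (i div x) * int ((n - i) div y))"
    unfolding fps_mult_nth by (rule sum.mono_neutral_cong_right) (auto simp: lambert_def)
  also have "\<dots> = (\<Sum>(a, b) | 0 < a \<and> 0 < b \<and> a * x + b * y = n. int (a * b))"
    using assms
    by (intro sum.reindex_bij_witness[of _ "\<lambda>(a, b). a * x" "\<lambda>i. (i div x, (n - i) div y)"])
      auto
  finally show ?thesis .
qed

lemma MO_2_eq:
  "MO 2 n = (\<Sum>(a, x, b, y) | (a, x, b, y) \<in> sols n \<and> x < y. int (a * b))"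
proof -
  \<comment> \<open>A term is divisible by \<open>q\<close> to the power \<open>x + y\<close>, so only \<open>y \<le> n\<close> can contribute.\<close>
  define P where "P = {(x, y). 1 \<le> x \<and> x < y \<and> y \<le> n}"
  define F where "F = (\<lambda>(x::nat, y::nat). {(a, b). 0 < a \<and> 0 < b \<and> a * x + b * y = n})"
  have finP: "finite P"
    by (rule finite_subset[of _ "{..n} \<times> {..n}"]) (auto simp: P_def)
  have finF: "finite (F p)" if "p \<in> P" for p
  proof (rule finite_subset[of _ "{..n} \<times> {..n}"])
    obtain x y where p: "p = (x, y)" by force
    with that have "x \<ge> 1" "y \<ge> 1" by (auto simp: P_def)
    then have "a \<le> a * x" "b \<le> b * y" for a b by auto
    then show "F p \<subseteq> {..n} \<times> {..n}"
      unfolding p F_def by (auto intro: order.trans trans_le_add1 trans_le_add2)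
  qed simp
  have term2: "fps_nth (MO_term [x, y]) n = (\<Sum>(a, b)\<in>F (x, y). int (a * b))"
    if "1 \<le> x" "x < y" for x y
  proof -
    have "[x, y] \<in> MO_index 2" using that by (auto simp: MO_index_def)
    from MO_term_eq_lambert[OF this] show ?thesis
      using that by (simp add: lambert_mult_nth F_def)
  qed
  have idx: "\<exists>x y. ks = [x, y] \<and> 1 \<le> x \<and> x < y" if "ks \<in> MO_index 2" for ks
    using that by (auto simp: MO_index_def numeral_2_eq_2 length_Suc_conv)
  have "MO 2 n = (\<Sum>ks\<in>(\<lambda>(x, y). [x, y]) ` P. fps_nth (MO_term ks) n)"
  proof (rule MO_eq_sum)
    show "(\<lambda>(x, y). [x, y]) ` P \<subseteq> MO_index 2" by (auto simp: P_def MO_index_def)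
    fix ks assume ks: "ks \<in> MO_index 2" "ks \<notin> (\<lambda>(x, y). [x, y]) ` P"
    then obtain x y where xy: "ks = [x, y]" "1 \<le> x" "x < y" using idx by blast
    with ks(2) have "y > n" by (auto simp: P_def image_iff)
    then have "n < x + y" by simp
    then show "fps_nth (MO_term ks) n = 0"
      by (simp add: xy MO_term_def fps_X_power_mult_nth)
  qed (use finP in simp)
  also have "\<dots> = (\<Sum>p\<in>P. \<Sum>(a, b)\<in>F p. int (a * b))"
    by (subst sum.reindex) (auto simp: inj_on_def P_def term2 intro!: sum.cong)
  also have "\<dots> = (\<Sum>(p, (a, b))\<in>Sigma P F. int (a * b))"
    using finP finF by (subst sum.Sigma) (auto simp: split_def)
  also have "\<dots> = (\<Sum>(a, x, b, y) | (a, x, b, y) \<in> sols n \<and> x < y. int (a * b))"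
  proof (rule sum.reindex_bij_witness[of _ "\<lambda>(a, x, b, y). ((x, y), (a, b))"
        "\<lambda>((x, y), (a, b)). (a, x, b, y)"], goal_cases)
    case (4 s)
    obtain a x b y where s: "s = (a, x, b, y)" by (metis prod.exhaust)
    with 4 have "0 < b" "a * x + b * y = n" by (auto simp: sols_def)
    then have "y \<le> n" by (cases b) auto
    with 4 s show ?case by (auto simp: P_def F_def sols_def)
  qed (auto simp: P_def F_def sols_def)
  finally show ?thesis .
qed

section \<open>A Euclidean step on the solutions\<close>

lemma sum_sols_swap:
  "(\<Sum>(a, x, b, y) | (a, x, b, y) \<in> sols n \<and> R a x b y. h a x b y) =
   (\<Sum>(a, x, b, y) | (a, x, b, y) \<in> sols n \<and> R b y a x. h b y a x)"
  by (rule sum.reindex_bij_witness[of _ "\<lambda>(a, x, b, y). (b, y, a, x)" "\<lambda>(a, x, b, y). (b, y, a, x)"])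
    (auto simp: sols_def)

text \<open>
  The Euclidean step rests on \<open>a x + b y = (a - b) x + b (x + y)\<close>. It leaves \<open>b\<close> and \<open>x\<close> alone and is
  invertible, since \<open>y' = x + y\<close> only has to exceed \<open>x\<close>.
\<close>

lemma sum_sols_euclid:
  "(\<Sum>(a, x, b, y) | (a, x, b, y) \<in> sols n \<and> b < a. h a b) =
   (\<Sum>(a, x, b, y) | (a, x, b, y) \<in> sols n \<and> x < y. h (a + b) b)"
  by (rule sum.reindex_bij_witness[of _ "\<lambda>(a, x, b, y). (a + b, x, b, y - x)"
        "\<lambda>(a, x, b, y). (a - b, x, b, x + y)"])
    (auto simp: sols_def algebra_simps dest!: less_imp_Suc_add)

lemma sum_sols_trichotomy:
  fixes u v :: "nat \<Rightarrow> nat \<Rightarrow> nat \<Rightarrow> nat \<Rightarrow> nat" and h :: "nat \<Rightarrow> nat \<Rightarrow> nat \<Rightarrow> nat \<Rightarrow> int"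
  shows "(\<Sum>(a, x, b, y)\<in>sols n. h a x b y) =
   (\<Sum>(a, x, b, y) | (a, x, b, y) \<in> sols n \<and> u a x b y < v a x b y. h a x b y) +
   (\<Sum>(a, x, b, y) | (a, x, b, y) \<in> sols n \<and> v a x b y < u a x b y. h a x b y) +
   (\<Sum>(a, x, b, y) | (a, x, b, y) \<in> sols n \<and> u a x b y = v a x b y. h a x b y)"
proof -
  define A where "A = {(a, x, b, y). (a, x, b, y) \<in> sols n \<and> u a x b y < v a x b y}"
  define B where "B = {(a, x, b, y). (a, x, b, y) \<in> sols n \<and> v a x b y < u a x b y}"
  define C where "C = {(a, x, b, y). (a, x, b, y) \<in> sols n \<and> u a x b y = v a x b y}"
  have sub: "A \<subseteq> sols n" "B \<subseteq> sols n" "C \<subseteq> sols n" by (auto simp: A_def B_def C_def)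
  have fin: "finite A" "finite B" "finite C"
    using sub[THEN finite_subset] finite_sols by auto
  have *: "A \<union> B \<union> C = sols n" by (auto simp: A_def B_def C_def)
  have **: "A \<inter> B = {}" "(A \<union> B) \<inter> C = {}" by (auto simp: A_def B_def C_def)
  have "sum f (sols n) = sum f A + sum f B + sum f C" for f :: "_ \<Rightarrow> int"
    unfolding *[symmetric] using fin ** by (simp add: sum.union_disjoint)
  then show ?thesis unfolding A_def B_def C_def by blast
qed

text \<open>
  Write \<open>Gt\<close>, \<open>Lt\<close>, \<open>Da\<close>, \<open>Dx\<close> for the sums over \<open>a > b\<close>, \<open>x < y\<close>, \<open>a = b\<close>, \<open>x = y\<close>. The sum over all
  solutions can be split by comparing \<open>a\<close> with \<open>b\<close> or \<open>x\<close> with \<open>y\<close>, which gives \<open>split_eq\<close>; the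
  Euclidean step rewrites \<open>Gt\<close> as \<open>Lt\<close>. For the weight \<open>a b\<close> this yields
  \<open>2 Lt(b\<^sup>2) + Da(a b) = Dx(a b)\<close>, and for \<open>a\<^sup>2\<close>, where \<open>Lt(a\<^sup>2)\<close> cancels, it yields
  \<open>2 Lt(a b) + Lt(b\<^sup>2) + Da(a\<^sup>2) = Dx(a\<^sup>2)\<close>. Eliminating \<open>Lt(b\<^sup>2)\<close> leaves only degenerate solutions.
\<close>

lemma four_times_sum_sols:
  "4 * (\<Sum>(a, x, b, y) | (a, x, b, y) \<in> sols n \<and> x < y. int (a * b)) =
   (\<Sum>(a, x, b, y) | (a, x, b, y) \<in> sols n \<and> x = y. int a ^ 2 + int b ^ 2 - int a * int b) -
   (\<Sum>(a, x, b, y) | (a, x, b, y) \<in> sols n \<and> a = b. int a ^ 2)"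
proof -
  define Gt where "Gt h = (\<Sum>(a, x, b, y) | (a, x, b, y) \<in> sols n \<and> b < a. h (int a) (int b))"
    for h :: "int \<Rightarrow> int \<Rightarrow> int"
  define Lt where "Lt h = (\<Sum>(a, x, b, y) | (a, x, b, y) \<in> sols n \<and> x < y. h (int a) (int b))"
    for h :: "int \<Rightarrow> int \<Rightarrow> int"
  define Da where "Da h = (\<Sum>(a, x, b, y) | (a, x, b, y) \<in> sols n \<and> a = b. h (int a) (int b))"
    for h :: "int \<Rightarrow> int \<Rightarrow> int"
  define Dx where "Dx h = (\<Sum>(a, x, b, y) | (a, x, b, y) \<in> sols n \<and> x = y. h (int a) (int b))"
    for h :: "int \<Rightarrow> int \<Rightarrow> int"
  have lin: "Lt (\<lambda>a b. f a b + g a b) = Lt f + Lt g" "Dx (\<lambda>a b. f a b + g a b) = Dx f + Dx g"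
    "Lt (\<lambda>a b. c * f a b) = c * Lt f" "Dx (\<lambda>a b. f a b - g a b) = Dx f - Dx g" for f g c
    by (simp_all add: Lt_def Dx_def split_def sum.distrib sum_distrib_left sum_subtractf)
  have euclid: "Gt h = Lt (\<lambda>a b. h (a + b) b)" for h
    using sum_sols_euclid[where n = n and h = "\<lambda>a b. h (int a) (int b)"] by (simp add: Gt_def Lt_def)
  have split_eq: "Gt h + Gt (\<lambda>a b. h b a) + Da h = Lt h + Lt (\<lambda>a b. h b a) + Dx h" for h
  proof -
    have "Gt (\<lambda>a b. h b a) = (\<Sum>(a, x, b, y) | (a, x, b, y) \<in> sols n \<and> a < b. h (int a) (int b))"
      unfolding Gt_def by (rule sum_sols_swap)
    moreover have "Lt (\<lambda>a b. h b a) = (\<Sum>(a, x, b, y) | (a, x, b, y) \<in> sols n \<and> y < x. h (int a) (int b))"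
      unfolding Lt_def by (rule sum_sols_swap)
    ultimately show ?thesis
      using sum_sols_trichotomy[where n = n and h = "\<lambda>a x b y. h (int a) (int b)"
          and u = "\<lambda>a x b y. a" and v = "\<lambda>a x b y. b"]
        sum_sols_trichotomy[where n = n and h = "\<lambda>a x b y. h (int a) (int b)"
          and u = "\<lambda>a x b y. x" and v = "\<lambda>a x b y. y"]
      unfolding Gt_def Lt_def Da_def Dx_def by linarith
  qed
  have ab: "Gt (\<lambda>a b. a * b) = Lt (\<lambda>a b. a * b) + Lt (\<lambda>a b. b\<^sup>2)"
    by (simp add: euclid lin(1)[symmetric] power2_eq_square distrib_right)
  have aa: "Gt (\<lambda>a b. a\<^sup>2) = Lt (\<lambda>a b. a\<^sup>2) + 2 * Lt (\<lambda>a b. a * b) + Lt (\<lambda>a b. b\<^sup>2)"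
  proof -
    have "Gt (\<lambda>a b. a\<^sup>2) = Lt (\<lambda>a b. a\<^sup>2 + 2 * (a * b) + b\<^sup>2)"
      by (simp add: euclid power2_eq_square algebra_simps)
    then show ?thesis by (simp only: lin)
  qed
  have bb: "Gt (\<lambda>a b. b\<^sup>2) = Lt (\<lambda>a b. b\<^sup>2)" by (simp add: euclid)
  have Da: "Da (\<lambda>a b. a * b) = Da (\<lambda>a b. a\<^sup>2)"
    by (auto simp: Da_def power2_eq_square intro!: sum.cong)
  have Dx: "Dx (\<lambda>a b. b\<^sup>2) = Dx (\<lambda>a b. a\<^sup>2)"
    unfolding Dx_def by (subst sum_sols_swap) (simp add: eq_commute)
  have comm: "(\<lambda>a b. b * a) = (\<lambda>a b. a * b :: int)" by (simp add: mult.commute)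
  have "4 * Lt (\<lambda>a b. a * b) = Dx (\<lambda>a b. a\<^sup>2) + Dx (\<lambda>a b. b\<^sup>2) - Dx (\<lambda>a b. a * b) - Da (\<lambda>a b. a\<^sup>2)"
    using split_eq[of "\<lambda>a b. a * b"] split_eq[of "\<lambda>a b. a\<^sup>2"] ab aa bb Da Dx
    unfolding comm by linarith
  then have "4 * Lt (\<lambda>a b. a * b) = Dx (\<lambda>a b. a\<^sup>2 + b\<^sup>2 - a * b) - Da (\<lambda>a b. a\<^sup>2)"
    by (simp add: lin)
  then show ?thesis by (simp add: Lt_def Dx_def Da_def)
qed

section \<open>The degenerate solutions as divisor sums\<close>

text \<open>If \<open>a = b = d\<close> then \<open>d (x + y) = n\<close>, so \<open>d\<close> divides \<open>n\<close> and \<open>y\<close> takes \<open>n/d - 1\<close> values.\<close>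

lemma sum_sols_eq_coeff:
  assumes "n > 0"
  shows "(\<Sum>(a, x, b, y) | (a, x, b, y) \<in> sols n \<and> a = b. int a ^ 2) =
    (\<Sum>d | d dvd n. int d * int n - int d ^ 2)"
proof -
  have "(\<Sum>(a, x, b, y) | (a, x, b, y) \<in> sols n \<and> a = b. int a ^ 2) =
      (\<Sum>(d, y)\<in>Sigma {d. d dvd n} (\<lambda>d. {1..<n div d}). int d ^ 2)"
  proof (rule sum.reindex_bij_witness[of _ "\<lambda>(d, y). (d, n div d - y, d, y)"
        "\<lambda>(a, x, b, y). (a, y)"], goal_cases)
    case (1 s)
    then obtain a x y where "s = (a, x, a, y)" "n = a * (x + y)" "0 < a"
      by (auto simp: sols_def distrib_left)
    then show ?case by simp
  next
    case (2 s)
    then obtain a x y where "s = (a, x, a, y)" "n = a * (x + y)" "0 < a" "0 < x" "0 < y"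
      by (auto simp: sols_def distrib_left)
    then show ?case by simp
  next
    case (4 t)
    then obtain d y where "t = (d, y)" "d dvd n" "0 < y" "y < n div d"
      by auto
    moreover from this obtain e where "n = d * e" by auto
    moreover from this assms have "0 < d" "n div d = e" by auto
    moreover from calculation have "d * y \<le> d * e" by simp
    ultimately show ?case by (simp add: sols_def diff_mult_distrib2)
  qed auto
  also have "\<dots> = (\<Sum>d | d dvd n. \<Sum>y = 1..<n div d. int d ^ 2)"
    using assms by (subst sum.Sigma) auto
  also have "\<dots> = (\<Sum>d | d dvd n. int d * int n - int d ^ 2)"
  proof (rule sum.cong)
    fix d assume "d \<in> {d. d dvd n}"
    then obtain e where e: "n = d * e" by auto
    with assms have "d > 0" "e > 0" by auto
    then show "(\<Sum>y = 1..<n div d. int d ^ 2) = int d * int n - int d ^ 2"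
      by (simp add: e of_nat_diff power2_eq_square algebra_simps)
  qed simp
  finally show ?thesis .
qed

lemma sum_quadratic_form:
  "2 * (\<Sum>b = 1..<d. (int d - int b)\<^sup>2 + (int b)\<^sup>2 - (int d - int b) * int b) = int d * (int d - 1)\<^sup>2"
proof (cases d)
  case (Suc m)
  \<comment> \<open>For an induction the upper limit has to be independent of the value \<open>c\<close> of \<open>a + b\<close>.\<close>
  have "2 * (\<Sum>b = 1..<Suc k. (c - int b)\<^sup>2 + (int b)\<^sup>2 - (c - int b) * int b) =
      int k * (2 * c\<^sup>2 - 3 * c * (int k + 1) + (int k + 1) * (2 * int k + 1))" for c :: int and k
    by (induction k) (simp_all add: power2_eq_square algebra_simps)
  from this[of "int d" m] show ?thesis
    by (simp add: Suc power2_eq_square algebra_simps)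
qed simp

text \<open>
  If \<open>x = y\<close> then \<open>(a + b) x = n\<close>: the divisor is \<open>d = a + b\<close>, and \<open>b\<close> runs through \<open>1, \<dots>, d - 1\<close>.
\<close>

lemma sum_sols_eq_var:
  assumes "n > 0"
  shows "2 * (\<Sum>(a, x, b, y) | (a, x, b, y) \<in> sols n \<and> x = y. int a ^ 2 + int b ^ 2 - int a * int b) =
    (\<Sum>d | d dvd n. int d * (int d - 1)\<^sup>2)"
proof -
  let ?q = "\<lambda>d b. (int d - int b)\<^sup>2 + (int b)\<^sup>2 - (int d - int b) * int b"
  have "(\<Sum>(a, x, b, y) | (a, x, b, y) \<in> sols n \<and> x = y. int a ^ 2 + int b ^ 2 - int a * int b) =
      (\<Sum>(d, b)\<in>Sigma {d. d dvd n} (\<lambda>d. {1..<d}). ?q d b)"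
  proof (rule sum.reindex_bij_witness[of _ "\<lambda>(d, b). (d - b, n div d, b, n div d)"
        "\<lambda>(a, x, b, y). (a + b, b)"], goal_cases)
    case (1 s)
    then obtain a x b where "s = (a, x, b, x)" "n = (a + b) * x" "0 < a + b"
      by (auto simp: sols_def distrib_right)
    then show ?case by simp
  next
    case (2 s)
    then obtain a x b where "s = (a, x, b, x)" "n = (a + b) * x" "0 < a" "0 < b"
      by (auto simp: sols_def distrib_right)
    then show ?case by simp
  next
    case (4 t)
    then obtain d b where "t = (d, b)" "d dvd n" "0 < b" "b < d"
      by auto
    moreover from this obtain e where "n = d * e" by auto
    moreover from this assms have "n div d = e" "0 < e" by auto
    moreover from calculation have "b * e \<le> d * e" by simp
    ultimately show ?case by (simp add: sols_def diff_mult_distrib)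
  qed auto
  also have "\<dots> = (\<Sum>d | d dvd n. \<Sum>b = 1..<d. ?q d b)"
    using assms by (subst sum.Sigma) auto
  also have "2 * \<dots> = (\<Sum>d | d dvd n. int d * (int d - 1)\<^sup>2)"
    by (simp only: sum_quadratic_form sum_distrib_left[of 2 _ "{d. d dvd n}"])
  finally show ?thesis .
qed

lemma eight_times_MO_2:
  assumes "n > 0"
  shows "8 * MO 2 n = (\<Sum>d | d dvd n. int d ^ 3 + (1 - 2 * int n) * int d)"
proof -
  have "8 * MO 2 n = (\<Sum>d | d dvd n. int d * (int d - 1)\<^sup>2) -
      2 * (\<Sum>d | d dvd n. int d * int n - int d ^ 2)"
    using four_times_sum_sols[of n] sum_sols_eq_var[OF assms] sum_sols_eq_coeff[OF assms]
    by (simp add: MO_2_eq)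
  also have "\<dots> = (\<Sum>d | d dvd n. int d ^ 3 + (1 - 2 * int n) * int d)"
    by (simp add: sum_distrib_left flip: sum_subtractf)
      (simp add: power2_eq_square power3_eq_cube algebra_simps)
  finally show ?thesis .
qed

section \<open>The congruence modulo 5\<close>

lemma divisor_pair_cong:
  fixes d e :: int
  assumes "[d * e = 2] (mod 5)"
  shows "5 dvd (d ^ 3 + (1 - 2 * (d * e)) * d) + (e ^ 3 + (1 - 2 * (d * e)) * e)"
proof -
  \<comment> \<open>Here \<open>1 - 2 d e \<equiv> -3\<close>; the finitely many pairs of residues are then checked one by one.\<close>
  have residues: "5 dvd (r ^ 3 + - 3 * r) + (s ^ 3 + - 3 * s)"
    if "r \<in> {0, 1, 2, 3, 4}" "s \<in> {0, 1, 2, 3, 4}" "r * s mod 5 = 2" for r s :: int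
    using that by (elim insertE emptyE) simp_all
  have range: "x mod 5 \<in> {0, 1, 2, 3, 4}" for x :: int
    by (simp; presburger)
  have "(d mod 5) * (e mod 5) mod 5 = 2"
    using assms by (simp add: cong_def mod_mult_eq)
  then have "5 dvd ((d mod 5) ^ 3 + - 3 * (d mod 5)) + ((e mod 5) ^ 3 + - 3 * (e mod 5))"
    by (rule residues[OF range range])
  moreover have "[1 - 2 * (d * e) = 1 - 2 * 2] (mod 5)"
    using assms by (intro cong_diff cong_mult cong_refl)
  then have "[(d ^ 3 + (1 - 2 * (d * e)) * d) + (e ^ 3 + (1 - 2 * (d * e)) * e) =
      ((d mod 5) ^ 3 + - 3 * (d mod 5)) + ((e mod 5) ^ 3 + - 3 * (e mod 5))] (mod 5)"
    by (intro cong_add cong_mult cong_pow) (simp_all add: cong_def)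
  ultimately show ?thesis
    by (simp only: cong_dvd_iff)
qed

theorem theorem8p4:
  fixes n :: nat
  shows "5 dvd MO 2 (5 * n + 2)"
proof -
  define N where "N = 5 * n + 2"
  define g where "g d = int d ^ 3 + (1 - 2 * int N) * int d" for d
  have "N > 0" by (simp add: N_def)
  have "(\<Sum>d | d dvd N. g (N div d)) = (\<Sum>d | d dvd N. g d)"
    by (rule sum.reindex_bij_witness[of _ "\<lambda>d. N div d" "\<lambda>d. N div d"])
      (use \<open>N > 0\<close> in \<open>auto elim!: dvdE\<close>)
  then have "16 * MO 2 N = (\<Sum>d | d dvd N. g d + g (N div d))"
    using eight_times_MO_2[OF \<open>N > 0\<close>] by (simp add: sum.distrib g_def)
  also have "5 dvd \<dots>"
  proof (rule dvd_sum)
    fix d assume "d \<in> {d. d dvd N}"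
    then obtain e where e: "N = d * e" by auto
    with \<open>N > 0\<close> have "N div d = e" by auto
    moreover have "[int d * int e = 2] (mod 5)"
    proof -
      have "int d * int e = int N" by (simp only: e of_nat_mult)
      then show ?thesis by (simp add: N_def cong_def)
    qed
    ultimately show "5 dvd g d + g (N div d)"
      using divisor_pair_cong[of "int d" "int e"] by (simp add: g_def e)
  qed
  finally have "5 dvd 16 * MO 2 N" .
  then show ?thesis unfolding N_def by presburger
qed

end
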